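(* Let $t$ be a closed $\rhd\beta_v$-normalizable term. Then for every derivation $\pi$ with conclusion $\vdash t\colon\mathbf{0}$ (empty environment) and every reduction sequence from $t$ to its $\rhd\beta_v$-normal form by $\rhd\beta_v$-steps, the number of steps of that sequence equals $|\pi|$.
   Context: Terms: $t ::= x \mid \lambda x.t \mid tu$ (up to $\alpha$); values $v ::= x \mid \lambda x.t$; closed means no free variables; $t\{v/x\}$ substitution. Root step ($\beta_v$): $(\lambda x.t)v \mapsto t\{v/x\}$ with $v$ a value. Balanced contexts $B ::= [\cdot] \mid (\lambda x.B)t \mid Bt \mid tB$; $\rhd\beta_v$-reduction is the closure of the root step under balanced contexts. Types: positive types are finite multisets $[(P_1,Q_1),\dots,(P_n,Q_n)]$ of pairs of positive types ($\mathbf{0}$ empty, $\uplus$ union). Environments map variables to positive types (finitely many non-$\mathbf{0}$), combined pointwise by $\uplus$. Rules: (ax) $x\colon P\vdash x\colon P$; ($\lambda$) from $\Gamma_i,x\colon P_i\vdash t\colon Q_i$ ($1\le i\le n$, $n\ge0$) infer $\biguplus_i\Gamma_i\vdash\lambda x.t\colon[(P_1,Q_1),\dots,(P_n,Q_n)]$; ($@$) from $\Gamma\vdash t\colon[(P,Q)]$ and $\Delta\vdash u\colon P$ infer $\Gamma\uplus\Delta\vdash tu\colon Q$. The size $|\pi|$ of a derivation is the number of $@$ rules in it. *)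

theory Defs
  imports "HOL-Library.Multiset"
begin

text \<open>Terms up to alpha-equivalence are represented by de Bruijn indices.\<close>

datatype trm = Var nat | Lam trm | App trm trm

fun is_value :: "trm \<Rightarrow> bool" where
  "is_value (Var i) = True"
| "is_value (Lam t) = True"
| "is_value (App t u) = False"

primrec fvs :: "trm \<Rightarrow> nat set" where
  "fvs (Var i) = {i}"
| "fvs (Lam t) = {i. Suc i \<in> fvs t}"
| "fvs (App t u) = fvs t \<union> fvs u"

definition closed_trm :: "trm \<Rightarrow> bool" where
  "closed_trm t \<longleftrightarrow> fvs t = {}"

primrec lift :: "nat \<Rightarrow> trm \<Rightarrow> trm" where
  "lift k (Var i) = (if i < k then Var i else Var (Suc i))"
| "lift k (Lam t) = Lam (lift (Suc k) t)"
| "lift k (App t u) = App (lift k t) (lift k u)"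

text \<open>\<open>subst t s k\<close> replaces index \<open>k\<close> by \<open>s\<close> in \<open>t\<close> and decrements the indices above \<open>k\<close>,
  since the binder that \<open>k\<close> referred to is erased by the root step.\<close>

primrec subst :: "trm \<Rightarrow> trm \<Rightarrow> nat \<Rightarrow> trm" where
  "subst (Var i) s k = (if k < i then Var (i - 1) else if i = k then s else Var i)"
| "subst (Lam t) s k = Lam (subst t (lift 0 s) (Suc k))"
| "subst (App t u) s k = App (subst t s k) (subst u s k)"

inductive root_bv :: "trm \<Rightarrow> trm \<Rightarrow> bool" where
  "is_value v \<Longrightarrow> root_bv (App (Lam t) v) (subst t v 0)"

datatype bctx =
    Hole
  | CLamApp bctx trm  \<comment> \<open>\<open>(\<lambda>x. B) t\<close>\<close>
  | CAppL bctx trm    \<comment> \<open>\<open>B t\<close>\<close>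
  | CAppR trm bctx    \<comment> \<open>\<open>t B\<close>\<close>

primrec plug :: "bctx \<Rightarrow> trm \<Rightarrow> trm" where
  "plug Hole s = s"
| "plug (CLamApp B t) s = App (Lam (plug B s)) t"
| "plug (CAppL B t) s = App (plug B s) t"
| "plug (CAppR t B) s = App t (plug B s)"

inductive bal_bv :: "trm \<Rightarrow> trm \<Rightarrow> bool" where
  "root_bv r s \<Longrightarrow> bal_bv (plug B r) (plug B s)"

definition normal :: "trm \<Rightarrow> bool" where
  "normal t \<longleftrightarrow> (\<nexists>u. bal_bv t u)"

definition normalizable :: "trm \<Rightarrow> bool" where
  "normalizable t \<longleftrightarrow> (\<exists>u. bal_bv\<^sup>*\<^sup>* t u \<and> normal u)"

text \<open>\<open>P \<multimap> Q\<close> is the pair \<open>(P, Q)\<close>; a positive type is a finite multiset of such pairs.\<close>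

datatype lty = Arr "lty multiset" "lty multiset" (infixr \<open>\<multimap>\<close> 60)

type_synonym pty = "lty multiset"

text \<open>Environments assign positive types to de Bruijn indices. Finiteness of the support is not
  imposed on the type, as it holds for all derivable judgements (lemma \<open>derives_finite_support\<close>).
  The environment \<open>\<Gamma>, x : P\<close> under a binder for \<open>x\<close> is \<open>case_nat P \<Gamma>\<close>.\<close>

type_synonym env = "nat \<Rightarrow> pty"

definition empty_env :: env where
  "empty_env = (\<lambda>_. {#})"

text \<open>Derivation trees. The constructor for abstractions has one subderivation per premise,
  and records the body, which no premise determines when there are none.\<close>

datatype deriv =
    DAx nat pty
  | DLam trm "deriv list"
  | DApp deriv deriv

text \<open>\<open>derives \<pi> \<Gamma> t P\<close>: \<open>\<pi>\<close> is a derivation with conclusion \<open>\<Gamma> \<turnstile> t : P\<close>.\<close>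

inductive derives :: "deriv \<Rightarrow> env \<Rightarrow> trm \<Rightarrow> pty \<Rightarrow> bool" where
  Ax: "derives (DAx x P) (empty_env(x := P)) (Var x) P"
| Lam: "(\<forall>i < length \<pi>s. derives (\<pi>s ! i) (case_nat (P i) (\<Gamma> i)) t (Q i)) \<Longrightarrow>
    derives (DLam t \<pi>s) (\<lambda>x. \<Sum>i < length \<pi>s. \<Gamma> i x) (Lam t)
      (\<Sum>i < length \<pi>s. {# P i \<multimap> Q i #})"
| App: "derives \<pi> \<Gamma> t {# P \<multimap> Q #} \<Longrightarrow> derives \<rho> \<Delta> u P \<Longrightarrow>
    derives (DApp \<pi> \<rho>) (\<lambda>x. \<Gamma> x + \<Delta> x) (App t u) Q"

primrec dsize :: "deriv \<Rightarrow> nat" where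
  "dsize (DAx x P) = 0"
| "dsize (DLam t \<pi>s) = sum_list (map dsize \<pi>s)"
| "dsize (DApp \<pi> \<rho>) = Suc (dsize \<pi> + dsize \<rho>)"

lemma derives_finite_support:
  "derives \<pi> \<Gamma> t P \<Longrightarrow> finite {x. \<Gamma> x \<noteq> {#}}"
proof (induction rule: derives.induct)
  case (Ax x P)
  have "{y. (empty_env(x := P)) y \<noteq> {#}} \<subseteq> {x}"
    by (auto simp: empty_env_def)
  then show ?case
    by (rule finite_subset) simp
next
  case (Lam \<pi>s P \<Gamma> t Q)
  have fin: "finite {x. \<Gamma> i x \<noteq> {#}}" if "i < length \<pi>s" for i
  proof -
    have "finite (Suc -` {x. case_nat (P i) (\<Gamma> i) x \<noteq> {#}})"
      using Lam that by (intro finite_vimageI) auto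
    then show ?thesis
      by (simp add: vimage_def)
  qed
  have "{x. (\<Sum>i < length \<pi>s. \<Gamma> i x) \<noteq> {#}} \<subseteq> (\<Union>i < length \<pi>s. {x. \<Gamma> i x \<noteq> {#}})"
    by (auto elim: sum.not_neutral_contains_not_neutral)
  then show ?case
    using fin by (meson finite_UN finite_lessThan finite_subset lessThan_iff)
next
  case (App \<pi> \<Gamma> t P Q \<rho> \<Delta> u)
  have "{x. \<Gamma> x + \<Delta> x \<noteq> {#}} \<subseteq> {x. \<Gamma> x \<noteq> {#}} \<union> {x. \<Delta> x \<noteq> {#}}"
    by auto
  then show ?case
    using App by (meson finite_UnI finite_subset)
qed

end

theory Submission
  imports Defs
begin

text \<open>Every \<open>\<rhd>\<beta>\<^sub>v\<close>-step removes exactly one application rule from a derivation and keeps its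
  conclusion. This rests on values having additive typings: a derivation of \<open>v : P \<uplus> Q\<close> splits into
  derivations of \<open>v : P\<close> and \<open>v : Q\<close>, and a derivation of \<open>v : 0\<close> has empty environment and size
  zero, so that substituting a value redistributes its derivation without duplication or loss.
  A normal form that is typable in the empty environment is a value, and a value of type \<open>0\<close> has
  size zero.\<close>

section \<open>Derivations reduced to their sizes\<close>

text \<open>Only the size of a derivation matters, so the derivation itself is dropped; the \<open>n\<close>-ary
  abstraction rule becomes a nullary and a binary one, which allows plain rule induction.\<close>

inductive sized :: "nat \<Rightarrow> env \<Rightarrow> trm \<Rightarrow> pty \<Rightarrow> bool" where
  sized_Var: "\<Gamma> = empty_env(x := P) \<Longrightarrow> sized 0 \<Gamma> (Var x) P"
| sized_Lam_empty: "\<Gamma> = empty_env \<Longrightarrow> sized 0 \<Gamma> (Lam t) {#}"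
| sized_Lam_add: "sized m (case_nat P \<Gamma>) t Q \<Longrightarrow> sized n \<Delta> (Lam t) M \<Longrightarrow>
    \<Theta> = (\<lambda>x. \<Gamma> x + \<Delta> x) \<Longrightarrow> k = m + n \<Longrightarrow> sized k \<Theta> (Lam t) (add_mset (P \<multimap> Q) M)"
| sized_App: "sized m \<Gamma> t {# P \<multimap> Q #} \<Longrightarrow> sized n \<Delta> u P \<Longrightarrow>
    \<Theta> = (\<lambda>x. \<Gamma> x + \<Delta> x) \<Longrightarrow> k = Suc (m + n) \<Longrightarrow> sized k \<Theta> (App t u) Q"

inductive_cases sized_VarE: "sized n \<Gamma> (Var x) P"
inductive_cases sized_LamE: "sized n \<Gamma> (Lam t) P"
inductive_cases sized_AppE: "sized n \<Gamma> (App t u) P"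

lemma derives_sized: "derives \<pi> \<Gamma> t P \<Longrightarrow> sized (dsize \<pi>) \<Gamma> t P"
proof (induction rule: derives.induct)
  case (Ax x P)
  show ?case unfolding dsize.simps by (rule sized_Var) (rule refl)
next
  case (Lam \<pi>s P \<Gamma> t Q)
  \<comment> \<open>Generalized from all premises to the first \<open>n\<close>, so that each step
    of the induction absorbs one premise with the binary rule.\<close>
  have "sized (\<Sum>i<n. dsize (\<pi>s ! i)) (\<lambda>x. \<Sum>i<n. \<Gamma> i x) (Lam t) (\<Sum>i<n. {# P i \<multimap> Q i #})"
    if "n \<le> length \<pi>s" for n
    using that
  proof (induction n)
    case 0
    then show ?case by (simp add: sized_Lam_empty empty_env_def)
  next
    case (Suc n)
    then have "sized (dsize (\<pi>s ! n)) (case_nat (P n) (\<Gamma> n)) t (Q n)"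
      using Lam by simp
    moreover have "sized (\<Sum>i<n. dsize (\<pi>s ! i)) (\<lambda>x. \<Sum>i<n. \<Gamma> i x) (Lam t)
        (\<Sum>i<n. {# P i \<multimap> Q i #})"
      using Suc by simp
    ultimately have "sized (\<Sum>i<Suc n. dsize (\<pi>s ! i)) (\<lambda>x. \<Sum>i<Suc n. \<Gamma> i x) (Lam t)
        (add_mset (P n \<multimap> Q n) (\<Sum>i<n. {# P i \<multimap> Q i #}))"
      by (rule sized_Lam_add) (auto simp: add.commute)
    then show ?case by simp
  qed
  from this[of "length \<pi>s"] show ?case
    by (simp add: sum_list_sum_nth atLeast0LessThan)
next
  case (App \<pi> \<Gamma> t P Q \<rho> \<Delta> u)
  then show ?case by (auto intro: sized_App)
qed

section \<open>Typings of values\<close>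

text \<open>An axiom of type \<open>{#}\<close> contributes nothing to the environment, and an
  abstraction gets type \<open>{#}\<close> only from the nullary rule.\<close>

lemma sized_value_empty:
  assumes "sized n \<Gamma> v {#}" "is_value v"
  shows "n = 0 \<and> \<Gamma> = empty_env"
  using assms by (cases v) (auto elim: sized_VarE sized_LamE simp: empty_env_def)

text \<open>An axiom splits into two axioms. For an abstraction, each premise goes to the side that
  receives its pair.\<close>

lemma sized_value_split:
  assumes "sized n \<Gamma> v (P + Q)" "is_value v"
  shows "\<exists>n1 n2 \<Gamma>1 \<Gamma>2. sized n1 \<Gamma>1 v P \<and> sized n2 \<Gamma>2 v Q \<and> n = n1 + n2 \<and>
    \<Gamma> = (\<lambda>x. \<Gamma>1 x + \<Gamma>2 x)"
  using assms
proof (induction n \<Gamma> v "P + Q" arbitrary: P Q rule: sized.induct)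
  case (sized_Var \<Gamma> x)
  have "sized 0 (empty_env(x := P)) (Var x) P" "sized 0 (empty_env(x := Q)) (Var x) Q"
    by (simp_all add: sized.sized_Var)
  moreover have "\<Gamma> = (\<lambda>y. (empty_env(x := P)) y + (empty_env(x := Q)) y)"
    using sized_Var by (auto simp: empty_env_def)
  ultimately show ?case by (metis add_0)
next
  case (sized_Lam_empty \<Gamma> t)
  have "sized 0 empty_env (Lam t) {#}"
    by (simp add: sized.sized_Lam_empty)
  moreover have "\<Gamma> = (\<lambda>x. empty_env x + empty_env x)" "P = {#}" "Q = {#}"
    using sized_Lam_empty by (auto simp: empty_env_def)
  ultimately show ?case by (metis add_0)
next
  case (sized_Lam_add m A \<Gamma> t B n \<Delta> M \<Theta> k)
  have "A \<multimap> B \<in># P + Q"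
    using sized_Lam_add(7) by (metis union_single_eq_member)
  \<comment> \<open>The pair added last may occur on both sides; either choice is sound, since the
    induction hypothesis covers every splitting of the remainder \<open>M\<close>.\<close>
  then consider "A \<multimap> B \<in># P" | "A \<multimap> B \<in># Q" by auto
  then show ?case
  proof cases
    case 1
    then obtain P' where P: "P = add_mset (A \<multimap> B) P'"
      by (metis mset_add)
    then have "M = P' + Q" using sized_Lam_add(7) by simp
    from sized_Lam_add(4)[OF this] obtain n1 n2 \<Gamma>1 \<Gamma>2 where
      s: "sized n1 \<Gamma>1 (Lam t) P'" "sized n2 \<Gamma>2 (Lam t) Q" "n = n1 + n2"
        "\<Delta> = (\<lambda>x. \<Gamma>1 x + \<Gamma>2 x)"
      by auto
    have "sized (m + n1) (\<lambda>x. \<Gamma> x + \<Gamma>1 x) (Lam t) P"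
      unfolding P by (rule sized.sized_Lam_add[OF sized_Lam_add(1) s(1)]) auto
    moreover have "k = (m + n1) + n2" "\<Theta> = (\<lambda>x. (\<Gamma> x + \<Gamma>1 x) + \<Gamma>2 x)"
      using s sized_Lam_add by (auto simp: add.assoc)
    ultimately show ?thesis using s(2) by blast
  next
    case 2
    then obtain Q' where Q: "Q = add_mset (A \<multimap> B) Q'"
      by (metis mset_add)
    then have "M = P + Q'" using sized_Lam_add(7) by simp
    from sized_Lam_add(4)[OF this] obtain n1 n2 \<Gamma>1 \<Gamma>2 where
      s: "sized n1 \<Gamma>1 (Lam t) P" "sized n2 \<Gamma>2 (Lam t) Q'" "n = n1 + n2"
        "\<Delta> = (\<lambda>x. \<Gamma>1 x + \<Gamma>2 x)"
      by auto
    have "sized (m + n2) (\<lambda>x. \<Gamma> x + \<Gamma>2 x) (Lam t) Q"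
      unfolding Q by (rule sized.sized_Lam_add[OF sized_Lam_add(1) s(2)]) auto
    moreover have "k = n1 + (m + n2)" "\<Theta> = (\<lambda>x. \<Gamma>1 x + (\<Gamma> x + \<Gamma>2 x))"
      using s sized_Lam_add by (auto simp: ac_simps)
    ultimately show ?thesis using s(1) by blast
  qed
qed auto

section \<open>Lifting and substitution\<close>

definition env_insert :: "nat \<Rightarrow> env \<Rightarrow> env" where
  "env_insert k \<Gamma> = (\<lambda>x. if x < k then \<Gamma> x else if x = k then {#} else \<Gamma> (x - 1))"

text \<open>The effect of \<open>subst\<close> on environments: the entry of the replaced index
  disappears and the later ones move down.\<close>

definition env_delete :: "nat \<Rightarrow> env \<Rightarrow> env" where
  "env_delete k \<Gamma> = (\<lambda>x. if x < k then \<Gamma> x else \<Gamma> (Suc x))"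

lemma env_insert_case_nat: "env_insert (Suc k) (case_nat P \<Gamma>) = case_nat P (env_insert k \<Gamma>)"
  by (auto simp: env_insert_def fun_eq_iff split: nat.split)

lemma sized_lift: "sized n \<Gamma> t P \<Longrightarrow> sized n (env_insert k \<Gamma>) (lift k t) P"
proof (induction arbitrary: k rule: sized.induct)
  case (sized_Var \<Gamma> x P)
  then show ?case
    by (auto intro!: sized.sized_Var simp: env_insert_def empty_env_def fun_eq_iff)
next
  case (sized_Lam_empty \<Gamma> t)
  then show ?case
    by (auto intro!: sized.sized_Lam_empty simp: env_insert_def empty_env_def fun_eq_iff)
next
  case (sized_Lam_add m P \<Gamma> t Q n \<Delta> M \<Theta> j)
  have "sized m (case_nat P (env_insert k \<Gamma>)) (lift (Suc k) t) Q"
    using sized_Lam_add.IH(1)[of "Suc k"] by (simp add: env_insert_case_nat)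
  moreover have "sized n (env_insert k \<Delta>) (Lam (lift (Suc k) t)) M"
    using sized_Lam_add.IH(2)[of k] by simp
  ultimately show ?case
    using sized_Lam_add.hyps
    by (auto intro!: sized.sized_Lam_add simp: env_insert_def fun_eq_iff)
next
  case (sized_App m \<Gamma> t P Q n \<Delta> u \<Theta> j)
  show ?case
    unfolding lift.simps
    by (rule sized.sized_App[OF sized_App.IH])
      (use sized_App.hyps in \<open>auto simp: env_insert_def fun_eq_iff\<close>)
qed

lemma is_value_lift: "is_value v \<Longrightarrow> is_value (lift k v)"
  by (cases v) auto

text \<open>The derivation of \<open>v\<close> is split along the branches of the derivation of
  \<open>t\<close>, and each piece lands on an axiom for index \<open>k\<close>. Axioms have size
  zero, so the sizes simply add up.\<close>

lemma sized_subst: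
  assumes "sized n \<Gamma> t P" "sized m \<Delta> v (\<Gamma> k)" "is_value v"
  shows "sized (n + m) (\<lambda>x. env_delete k \<Gamma> x + \<Delta> x) (subst t v k) P"
  using assms
proof (induction arbitrary: m \<Delta> v k rule: sized.induct)
  case (sized_Var \<Gamma> x P)
  show ?case
  proof (cases "x = k")
    case True
    then have "(\<lambda>x. env_delete k \<Gamma> x + \<Delta> x) = \<Delta>" "\<Gamma> k = P"
      using sized_Var by (auto simp: env_delete_def empty_env_def fun_eq_iff)
    moreover have "subst (Var x) v k = v"
      using True by simp
    ultimately show ?thesis using sized_Var.prems by (simp only: add_0)
  next
    case False
    \<comment> \<open>Here \<Gamma> assigns \<open>{#}\<close> to \<open>k\<close>, so discarding
      \<open>v\<close> loses neither size nor environment.\<close>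
    then have "m = 0 \<and> \<Delta> = empty_env"
      using sized_Var by (intro sized_value_empty) (auto simp: empty_env_def)
    with False show ?thesis
      using sized_Var.hyps
      by (auto intro!: sized.sized_Var simp: env_delete_def empty_env_def fun_eq_iff)
  qed
next
  case (sized_Lam_empty \<Gamma> t)
  then have "m = 0 \<and> \<Delta> = empty_env"
    by (intro sized_value_empty) (auto simp: empty_env_def)
  then show ?case
    using sized_Lam_empty
    by (auto intro!: sized.sized_Lam_empty simp: env_delete_def empty_env_def fun_eq_iff)
next
  case (sized_Lam_add a P \<Gamma> t Q b \<Gamma>' M \<Theta> j)
  then have "sized m \<Delta> v (\<Gamma> k + \<Gamma>' k)" by simp
  from sized_value_split[OF this \<open>is_value v\<close>] obtain m1 m2 \<Delta>1 \<Delta>2 where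
    s: "sized m1 \<Delta>1 v (\<Gamma> k)" "sized m2 \<Delta>2 v (\<Gamma>' k)" "m = m1 + m2" "\<Delta> = (\<lambda>x. \<Delta>1 x + \<Delta>2 x)"
    by blast
  \<comment> \<open>Under the binder, index \<open>k\<close> becomes \<open>Suc k\<close> and keeps
    its type, while the lifted value does not use index 0.\<close>
  have "sized m1 (env_insert 0 \<Delta>1) (lift 0 v) (case_nat P \<Gamma> (Suc k))"
    using sized_lift[OF s(1)] by simp
  from sized_Lam_add.IH(1)[OF this is_value_lift[OF \<open>is_value v\<close>]]
  have "sized (a + m1) (\<lambda>x. env_delete (Suc k) (case_nat P \<Gamma>) x + env_insert 0 \<Delta>1 x)
      (subst t (lift 0 v) (Suc k)) Q" .
  also have "(\<lambda>x. env_delete (Suc k) (case_nat P \<Gamma>) x + env_insert 0 \<Delta>1 x) =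
      case_nat P (\<lambda>x. env_delete k \<Gamma> x + \<Delta>1 x)"
    by (auto simp: env_delete_def env_insert_def fun_eq_iff split: nat.split)
  finally have "sized (a + m1) (case_nat P (\<lambda>x. env_delete k \<Gamma> x + \<Delta>1 x))
      (subst t (lift 0 v) (Suc k)) Q" .
  moreover have "sized (b + m2) (\<lambda>x. env_delete k \<Gamma>' x + \<Delta>2 x)
      (Lam (subst t (lift 0 v) (Suc k))) M"
    using sized_Lam_add.IH(2)[OF s(2) \<open>is_value v\<close>] by simp
  ultimately show ?case
    unfolding subst.simps
    by (rule sized.sized_Lam_add)
      (use sized_Lam_add.hyps s in \<open>auto simp: env_delete_def fun_eq_iff ac_simps\<close>)
next
  case (sized_App a \<Gamma> t P Q b \<Gamma>' u \<Theta> j)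
  then have "sized m \<Delta> v (\<Gamma> k + \<Gamma>' k)" by simp
  from sized_value_split[OF this \<open>is_value v\<close>] obtain m1 m2 \<Delta>1 \<Delta>2 where
    s: "sized m1 \<Delta>1 v (\<Gamma> k)" "sized m2 \<Delta>2 v (\<Gamma>' k)" "m = m1 + m2" "\<Delta> = (\<lambda>x. \<Delta>1 x + \<Delta>2 x)"
    by blast
  show ?case
    unfolding subst.simps
    by (rule sized.sized_App[OF sized_App.IH(1)[OF s(1)] sized_App.IH(2)[OF s(2)]])
      (use sized_App s in \<open>auto simp: env_delete_def fun_eq_iff ac_simps\<close>)
qed

section \<open>Each step decreases the size by one\<close>

text \<open>A term in function position has a singleton type; if it is an abstraction, its body is
  therefore typed exactly once.\<close>

lemma sized_Lam_singleton:
  "sized n \<Gamma> (Lam t) {# P \<multimap> Q #} \<longleftrightarrow> sized n (case_nat P \<Gamma>) t Q"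
proof
  assume "sized n \<Gamma> (Lam t) {# P \<multimap> Q #}"
  then obtain m k \<Gamma>' \<Delta> where
    s: "sized m (case_nat P \<Gamma>') t Q" "sized k \<Delta> (Lam t) {#}" "n = m + k"
      "\<Gamma> = (\<lambda>x. \<Gamma>' x + \<Delta> x)"
    by (auto elim: sized_LamE)
  from sized_value_empty[OF s(2)] s show "sized n (case_nat P \<Gamma>) t Q"
    by (simp add: empty_env_def)
next
  assume "sized n (case_nat P \<Gamma>) t Q"
  then show "sized n \<Gamma> (Lam t) {# P \<multimap> Q #}"
    by (rule sized_Lam_add[OF _ sized_Lam_empty]) (auto simp: empty_env_def)
qed

lemma sized_root_bv:
  assumes "root_bv r s" "sized n \<Gamma> r P"
  shows "\<exists>m. n = Suc m \<and> sized m \<Gamma> s P"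
  using assms
proof cases
  case (1 v t)
  with assms(2) obtain m k \<Gamma>' \<Delta> A where
    s: "sized m (case_nat A \<Gamma>') t P" "sized k \<Delta> v A" "n = Suc (m + k)"
      "\<Gamma> = (\<lambda>x. \<Gamma>' x + \<Delta> x)"
    by (auto elim!: sized_AppE simp: sized_Lam_singleton)
  \<comment> \<open>The \<open>Suc\<close> in \<open>n\<close> is the application rule of the redex,
    which the step erases; \<open>env_delete 0\<close> undoes \<open>case_nat A\<close>.\<close>
  have "sized (m + k) (\<lambda>x. env_delete 0 (case_nat A \<Gamma>') x + \<Delta> x) (subst t v 0) P"
    by (rule sized_subst[OF s(1)]) (use s 1 in simp_all)
  then show ?thesis using s 1 by (simp add: env_delete_def)
qed

text \<open>A balanced context crosses an abstraction only when it is applied, so the hole is typed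
  exactly once: the redex is neither duplicated nor skipped by the derivation.\<close>

lemma sized_plug:
  assumes "root_bv r s" "sized n \<Gamma> (plug B r) P"
  shows "\<exists>m. n = Suc m \<and> sized m \<Gamma> (plug B s) P"
  using assms(2)
proof (induction B arbitrary: n \<Gamma> P)
  case Hole
  then show ?case using sized_root_bv[OF assms(1)] by simp
next
  case (CLamApp B u)
  then obtain m k \<Gamma>' \<Delta> A where
    s: "sized m (case_nat A \<Gamma>') (plug B r) P" "sized k \<Delta> u A" "n = Suc (m + k)"
      "\<Gamma> = (\<lambda>x. \<Gamma>' x + \<Delta> x)"
    by (auto elim!: sized_AppE simp: sized_Lam_singleton)
  from CLamApp.IH[OF s(1)] s show ?case
    by (auto intro!: sized_App simp: sized_Lam_singleton)
next
  case (CAppL B u)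
  then obtain m k \<Gamma>' \<Delta> A where
    s: "sized m \<Gamma>' (plug B r) {# A \<multimap> P #}" "sized k \<Delta> u A" "n = Suc (m + k)"
      "\<Gamma> = (\<lambda>x. \<Gamma>' x + \<Delta> x)"
    by (auto elim!: sized_AppE)
  from CAppL.IH[OF s(1)] s show ?case
    by (auto intro!: sized_App)
next
  case (CAppR u B)
  then obtain m k \<Gamma>' \<Delta> A where
    s: "sized m \<Gamma>' u {# A \<multimap> P #}" "sized k \<Delta> (plug B r) A" "n = Suc (m + k)"
      "\<Gamma> = (\<lambda>x. \<Gamma>' x + \<Delta> x)"
    by (auto elim!: sized_AppE)
  from CAppR.IH[OF s(2)] s show ?case
    by (auto intro!: sized_App)
qed

lemma sized_bal_bv: "bal_bv t u \<Longrightarrow> sized n \<Gamma> t P \<Longrightarrow> \<exists>m. n = Suc m \<and> sized m \<Gamma> u P"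
  by (auto elim!: bal_bv.cases intro: sized_plug)

lemma sized_bal_bv_relpowp:
  "(bal_bv ^^ k) t u \<Longrightarrow> sized n \<Gamma> t P \<Longrightarrow> \<exists>m. n = k + m \<and> sized m \<Gamma> u P"
proof (induction k arbitrary: u)
  case 0
  then show ?case by simp
next
  case (Suc k)
  from Suc.prems(1) obtain s where s: "(bal_bv ^^ k) t s" "bal_bv s u"
    by (rule relpowp_Suc_E)
  from Suc.IH[OF s(1) Suc.prems(2)] obtain m where "n = k + m" "sized m \<Gamma> s P"
    by blast
  with sized_bal_bv[OF s(2)] show ?case by fastforce
qed

section \<open>Normal forms\<close>

lemma normal_App:
  assumes "normal (App t u)"
  shows "normal t" "normal u" "\<not> root_bv (App t u) s"
proof -
  have "bal_bv (App t u) (App t' u)" if "bal_bv t t'" for t'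
    using that bal_bv.intros[of _ _ "CAppL _ u"] by (auto elim!: bal_bv.cases)
  moreover have "bal_bv (App t u) (App t u')" if "bal_bv u u'" for u'
    using that bal_bv.intros[of _ _ "CAppR t _"] by (auto elim!: bal_bv.cases)
  moreover have "bal_bv (App t u) s" if "root_bv (App t u) s"
    using that bal_bv.intros[of _ _ Hole] by auto
  ultimately show "normal t" "normal u" "\<not> root_bv (App t u) s"
    using assms unfolding normal_def by blast+
qed

text \<open>In an application, both parts would be values by induction. The function part cannot be
  a variable, as its axiom would put a nonempty type in the environment, so it is an abstraction and
  there is a redex.\<close>

lemma normal_sized_empty_env_is_value:
  "normal t \<Longrightarrow> sized n empty_env t P \<Longrightarrow> is_value t"
proof (induction t arbitrary: n P)
  case (App t u)
  from App.prems(2) obtain m k \<Gamma> \<Delta> A where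
    s: "sized m \<Gamma> t {# A \<multimap> P #}" "sized k \<Delta> u A" "empty_env = (\<lambda>x. \<Gamma> x + \<Delta> x)"
    by (auto elim: sized_AppE)
  \<comment> \<open>A multiset union is empty only if both of its parts are.\<close>
  then have env: "\<Gamma> = empty_env" "\<Delta> = empty_env"
    by (auto simp: empty_env_def fun_eq_iff)
  have "is_value t" "is_value u"
    using App.IH s env normal_App[OF App.prems(1)] by blast+
  moreover have "t \<noteq> Var x" for x
  proof
    assume "t = Var x"
    with s(1) env(1) have "empty_env = empty_env(x := {# A \<multimap> P #})"
      by (auto elim: sized_VarE)
    from fun_cong[OF this, of x] show False
      by (simp add: empty_env_def)
  qed
  ultimately obtain b where "t = Lam b"
    by (cases t) auto
  then have "root_bv (App t u) (subst b u 0)"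
    using \<open>is_value u\<close> by (simp add: root_bv.intros)
  then show ?case
    using normal_App(3)[OF App.prems(1)] by blast
qed auto

theorem mainTheorem8:
  fixes t u :: trm and \<pi> :: deriv and n :: nat
  assumes "closed_trm t"
    and "normalizable t"
    and "derives \<pi> empty_env t {#}"
    and "(bal_bv ^^ n) t u"
    and "normal u"
  shows "n = dsize \<pi>"
proof -
  obtain m where m: "dsize \<pi> = n + m" "sized m empty_env u {#}"
    using sized_bal_bv_relpowp[OF assms(4) derives_sized[OF assms(3)]] by blast
  \<comment> \<open>The remaining size \<open>m\<close> is that of a value of type
    \<open>{#}\<close>, hence zero.\<close>
  have "is_value u"
    using normal_sized_empty_env_is_value[OF assms(5) m(2)] .
  with m show ?thesis
    using sized_value_empty by auto
qed

end
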